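(* Let $X,E\in\mathbb{R}^{p_1\times p_2}$ and $\hat X=X+E$, with partitioned singular value decompositions $X=U\Sigma V^\top+U_\perp\Sigma_\perp V_\perp^\top$ and $\hat X=\hat U\hat\Sigma\hat V^\top+\hat U_\perp\hat\Sigma_\perp\hat V_\perp^\top$, where $\sigma_r(X)>\sigma_{r+1}(X)$. If $\hat X$ has rank at least $r$, then $\hat U-UW_U\in\mathbb{R}^{p_1\times r}$ admits the decomposition $$\begin{aligned}\hat U-UW_U&=(I-UU^\top)EVW_V\hat\Sigma^{-1}\\&\quad+(I-UU^\top)E(\hat V-VW_V)\hat\Sigma^{-1}\\&\quad+(I-UU^\top)X(\hat V-VV^\top\hat V)\hat\Sigma^{-1}\\&\quad+U(U^\top\hat U-W_U).\end{aligned}$$ This decomposition still holds when the orthogonal matrices $W_U$ and $W_V$ are replaced by any real $r\times r$ matrices $T_1$ and $T_2$, respectively. The analogous decomposition for $\hat V-VW_V$ holds, with $U,\hat U,V,\hat V,E,X,W_U,W_V$ replaced by $V,\hat V,U,\hat U,E^\top,X^\top,W_V,W_U$, respectively; that is, $$\begin{aligned}\hat V-VW_V&=(I-VV^\top)E^\top UW_U\hat\Sigma^{-1}+(I-VV^\top)E^\top(\hat U-UW_U)\hat\Sigma^{-1}\\&\quad+(I-VV^\top)X^\top(\hat U-UU^\top\hat U)\hat\Sigma^{-1}+V(V^\top\hat V-W_V).\end{aligned}$$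
   Context: Here $p_1,p_2,r$ are positive integers with $r\le\min(p_1,p_2)$, and $\sigma_1(M)\ge\sigma_2(M)\ge\cdots\ge0$ denote the singular values of a matrix $M$ (with $\sigma_k(M)=0$ for $k$ exceeding the smaller dimension). In the decomposition of $X$: $U\in\mathbb{R}^{p_1\times r}$ and $V\in\mathbb{R}^{p_2\times r}$ have orthonormal columns, $[U|U_\perp]\in\mathbb{R}^{p_1\times p_1}$ and $[V|V_\perp]\in\mathbb{R}^{p_2\times p_2}$ are orthogonal, $\Sigma=\mathrm{diag}(\sigma_1(X),\dots,\sigma_r(X))$, and $\Sigma_\perp\in\mathbb{R}^{(p_1-r)\times(p_2-r)}$ has the remaining singular values $\sigma_{r+1}(X),\dots$ on its main diagonal and zeros elsewhere. The quantities $\hat U,\hat U_\perp,\hat V,\hat V_\perp,\hat\Sigma,\hat\Sigma_\perp$ are defined analogously for $\hat X$ (so $\hat\Sigma$ contains the $r$ largest singular values of $\hat X$). $W_U$ and $W_V$ are the Frobenius-optimal Procrustes matrices: if $U^\top\hat U=W_1\Sigma_UW_2^\top$ is a singular value decomposition of the $r\times r$ matrix $U^\top\hat U$, then $W_U:=W_1W_2^\top$; $W_V$ is defined in the same way from $V^\top\hat V$. *)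

theory Defs
  imports
    "HOL-Library.Multiset"
    "Jordan_Normal_Form.Matrix"
    "Jordan_Normal_Form.Char_Poly"
    "Jordan_Normal_Form.DL_Rank"
    "Jordan_Normal_Form.Gauss_Jordan_Elimination"
begin

definition orthonormal_cols :: "real mat \<Rightarrow> bool" where
  "orthonormal_cols A \<longleftrightarrow> transpose_mat A * A = 1\<^sub>m (dim_col A)"

text \<open>The library predicate \<open>orthogonal_mat\<close> only requires nonzero, pairwise orthogonal
  columns; here orthogonality includes normalization.\<close>

definition orthogonal_matrix :: "nat \<Rightarrow> real mat \<Rightarrow> bool" where
  "orthogonal_matrix n A \<longleftrightarrow>
     A \<in> carrier_mat n n \<and> transpose_mat A * A = 1\<^sub>m n \<and> A * transpose_mat A = 1\<^sub>m n"

text \<open>The singular values are indexed from 1: \<open>singular_value M k\<close> is the square root of the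
  \<open>k\<close>-th largest eigenvalue of \<open>M\<^sup>T M\<close>, counted with algebraic multiplicity, and 0 when \<open>k\<close>
  exceeds the smaller dimension of \<open>M\<close>.\<close>

definition gram_eigenvalues :: "real mat \<Rightarrow> real list" where
  "gram_eigenvalues M =
     rev (sorted_list_of_multiset (proots (char_poly (transpose_mat M * M))))"

definition singular_value :: "real mat \<Rightarrow> nat \<Rightarrow> real" where
  "singular_value M k =
     (if 1 \<le> k \<and> k \<le> min (dim_row M) (dim_col M)
      then sqrt (gram_eigenvalues M ! (k - 1)) else 0)"

text \<open>The \<open>m \<times> n\<close> matrix with \<open>\<sigma>\<^sub>o\<^sub>+\<^sub>1(M), \<sigma>\<^sub>o\<^sub>+\<^sub>2(M), \<dots>\<close> on its main diagonal and zeros elsewhere.\<close>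

definition sv_diag :: "real mat \<Rightarrow> nat \<Rightarrow> nat \<Rightarrow> nat \<Rightarrow> real mat" where
  "sv_diag M o' m n = mat m n (\<lambda>(i, j). if i = j then singular_value M (o' + i + 1) else 0)"

definition is_svd :: "real mat \<Rightarrow> real mat \<Rightarrow> real mat \<Rightarrow> real mat \<Rightarrow> bool" where
  "is_svd M A S B \<longleftrightarrow>
     orthogonal_matrix (dim_row M) A \<and> orthogonal_matrix (dim_col M) B \<and>
     S = sv_diag M 0 (dim_row M) (dim_col M) \<and>
     M = A * S * transpose_mat B"

definition join_cols :: "real mat \<Rightarrow> real mat \<Rightarrow> real mat" where
  "join_cols A B = mat_of_cols (dim_row A) (cols A @ cols B)"

text \<open>\<open>M = U S V\<^sup>T + U\<^sub>\<bottom> S\<^sub>\<bottom> V\<^sub>\<bottom>\<^sup>T\<close>, where \<open>S\<close> holds the \<open>r\<close> largest singular values. The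
  blocks with index \<open>\<bottom>\<close> have no columns (or no rows) when \<open>r\<close> equals \<open>p1\<close> or \<open>p2\<close>.\<close>

definition partitioned_svd ::
  "nat \<Rightarrow> nat \<Rightarrow> nat \<Rightarrow> real mat \<Rightarrow> real mat \<Rightarrow> real mat \<Rightarrow> real mat \<Rightarrow>
   real mat \<Rightarrow> real mat \<Rightarrow> real mat \<Rightarrow> bool" where
  "partitioned_svd p1 p2 r M U S V Up Sp Vp \<longleftrightarrow>
     M \<in> carrier_mat p1 p2 \<and>
     U \<in> carrier_mat p1 r \<and> Up \<in> carrier_mat p1 (p1 - r) \<and>
     V \<in> carrier_mat p2 r \<and> Vp \<in> carrier_mat p2 (p2 - r) \<and>
     orthonormal_cols U \<and> orthonormal_cols V \<and>
     orthogonal_matrix p1 (join_cols U Up) \<and> orthogonal_matrix p2 (join_cols V Vp) \<and>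
     S = sv_diag M 0 r r \<and> Sp = sv_diag M r (p1 - r) (p2 - r) \<and>
     M = U * S * transpose_mat V + Up * Sp * transpose_mat Vp"

text \<open>The Procrustes matrix need not be unique when \<open>U\<^sup>T U'\<close> is singular, as it depends on the
  chosen singular value decomposition; it is therefore a relation.\<close>

definition is_procrustes :: "real mat \<Rightarrow> real mat \<Rightarrow> real mat \<Rightarrow> bool" where
  "is_procrustes U U' W \<longleftrightarrow>
     (\<exists>W1 S W2. is_svd (transpose_mat U * U') W1 S W2 \<and> W = W1 * transpose_mat W2)"

text \<open>Only meaningful for invertible \<open>A\<close>.\<close>

definition inverse_mat :: "real mat \<Rightarrow> real mat" where
  "inverse_mat A = the (mat_inverse A)"

end

theory Submission
  imports Defs
begin

text \<open>The identity is linear algebra once two things are known. First, a partitioned singular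
  value decomposition intertwines its leading blocks: \<open>X V = U \<Sigma>\<close> and \<open>X\<^sup>T U = V \<Sigma>\<close>, and likewise
  for \<open>X + E\<close> (\<open>partitioned_svd_intertwines\<close>). Secondly, the leading singular values of \<open>X + E\<close>
  are nonzero, so that \<open>\<Sigma>h\<close> can be inverted (\<open>leading_sv_diag_invertible\<close>).

  Put \<open>P = I - U U\<^sup>T\<close>. Then \<open>P U = 0\<close>, hence \<open>P X V = P U \<Sigma> = 0\<close>, so subtracting \<open>V V\<^sup>T Vh\<close> from
  \<open>Vh\<close> changes nothing after multiplication by \<open>P X\<close>. The two terms containing \<open>E\<close> add up to
  \<open>P E Vh \<Sigma>h\<^sup>-\<^sup>1\<close> whatever \<open>T2\<close> is. Together the first three terms are therefore
  \<open>P (X + E) Vh \<Sigma>h\<^sup>-\<^sup>1 = P Uh = Uh - U U\<^sup>T Uh\<close>, and the last term replaces \<open>U U\<^sup>T Uh\<close> by \<open>U T1\<close>.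
  This is \<open>perturbed_factor_decomposition\<close>; it mentions no singular values, so the statement for
  the right singular vectors is its instance for the transposed matrices, with the roles of
  \<open>U\<close> and \<open>V\<close> exchanged.

  For invertibility, suppose that the \<open>k\<close>-th singular value of \<open>M\<close> vanishes for some \<open>k \<le> r\<close>. So do
  all later ones, and the decomposition writes \<open>M\<close> as a sum of \<open>k - 1\<close> matrices of rank at most
  one, which contradicts a rank of at least \<open>r\<close>. That later singular values vanish is not
  immediate, because they are defined from the list of real roots of the characteristic
  polynomial of \<open>M\<^sup>T M\<close>: this list must be shown to be long enough and nonnegative. Both follow
  from the fact that \<open>M\<^sup>T M\<close> is similar to a diagonal matrix whose entries are sums of squares.\<close>

section \<open>From a partitioned to a full singular value decomposition\<close>

lemma transpose_sandwich:
  fixes A D B :: "real mat"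
  assumes A: "A \<in> carrier_mat m a" and D: "D \<in> carrier_mat a b" and B: "B \<in> carrier_mat n b"
  shows "transpose_mat (A * D * transpose_mat B) = B * transpose_mat D * transpose_mat A"
proof -
  have "transpose_mat (A * D * transpose_mat B) = B * (transpose_mat D * transpose_mat A)"
    using transpose_mult[of "A * D" m b "transpose_mat B" n] transpose_mult[OF A D] A D B by simp
  also have "\<dots> = B * transpose_mat D * transpose_mat A"
    using A D B by (intro assoc_mult_mat[symmetric]) auto
  finally show ?thesis .
qed

text \<open>A four-block matrix without lower rows: in this form, products and transposes of
  concatenated matrices follow from the block rules.\<close>

lemma join_cols_eq_four_block:
  assumes "A \<in> carrier_mat n a" and "B \<in> carrier_mat n b"
  shows "join_cols A B = four_block_mat A B (0\<^sub>m 0 a) (0\<^sub>m 0 b)"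
  using assms unfolding join_cols_def
  by (intro eq_matI) (auto simp: mat_of_cols_index nth_append)

lemma join_cols_orthogonal_blocks:
  assumes A: "A \<in> carrier_mat n a" and B: "B \<in> carrier_mat n b"
    and J: "transpose_mat (join_cols A B) * join_cols A B = 1\<^sub>m (a + b)"
  shows "transpose_mat A * A = 1\<^sub>m a" and "transpose_mat B * A = 0\<^sub>m b a"
proof -
  have "transpose_mat (join_cols A B) * join_cols A B =
      four_block_mat (transpose_mat A * A) (transpose_mat A * B)
        (transpose_mat B * A) (transpose_mat B * B)"
    unfolding join_cols_eq_four_block[OF A B]
    using A B by (simp add: transpose_four_block_mat[of _ n a _ b _ 0] mult_four_block_mat[of _ a n _ 0 _ b _ _ a _ b])
  with J have eq: "four_block_mat (transpose_mat A * A) (transpose_mat A * B)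
        (transpose_mat B * A) (transpose_mat B * B) = 1\<^sub>m (a + b)" by simp
  show "transpose_mat A * A = 1\<^sub>m a"
  proof (rule eq_matI)
    fix i j assume "i < dim_row (1\<^sub>m a :: real mat)" "j < dim_col (1\<^sub>m a :: real mat)"
    then show "(transpose_mat A * A) $$ (i, j) = 1\<^sub>m a $$ (i, j)"
      using arg_cong[OF eq, of "\<lambda>M. M $$ (i, j)"] A B by (simp del: index_mult_mat(1))
  qed (use A in auto)
  show "transpose_mat B * A = 0\<^sub>m b a"
  proof (rule eq_matI)
    fix i j assume "i < dim_row (0\<^sub>m b a :: real mat)" "j < dim_col (0\<^sub>m b a :: real mat)"
    then show "(transpose_mat B * A) $$ (i, j) = 0\<^sub>m b a $$ (i, j)"
      using arg_cong[OF eq, of "\<lambda>M. M $$ (a + i, j)"] A B by (simp del: index_mult_mat(1))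
  qed (use A B in auto)
qed

lemma sv_diag_carrier [simp]: "sv_diag M k m n \<in> carrier_mat m n"
  by (simp add: sv_diag_def)

lemma sv_diag_four_block:
  assumes "r \<le> m" and "r \<le> n"
  shows "four_block_mat (sv_diag M 0 r r) (0\<^sub>m r (n - r)) (0\<^sub>m (m - r) r) (sv_diag M r (m - r) (n - r))
    = sv_diag M 0 m n"
  using assms by (intro eq_matI) (auto simp: sv_diag_def)

text \<open>Concatenating the blocks turns \<open>U S V\<^sup>T + U\<^sub>\<bottom> S\<^sub>\<bottom> V\<^sub>\<bottom>\<^sup>T\<close> into the product of three matrices,
  because the middle factor is block diagonal; that factor is the rectangular diagonal matrix of
  all singular values.\<close>

lemma partitioned_svd_is_svd:
  assumes svd: "partitioned_svd p1 p2 r M U S V Up Sp Vp" and r: "r \<le> p1" "r \<le> p2"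
  shows "is_svd M (join_cols U Up) (sv_diag M 0 p1 p2) (join_cols V Vp)"
proof -
  note d = svd[unfolded partitioned_svd_def]
  from d have M: "M \<in> carrier_mat p1 p2" and U: "U \<in> carrier_mat p1 r"
    and Up: "Up \<in> carrier_mat p1 (p1 - r)" and V: "V \<in> carrier_mat p2 r"
    and Vp: "Vp \<in> carrier_mat p2 (p2 - r)" and S: "S = sv_diag M 0 r r"
    and Sp: "Sp = sv_diag M r (p1 - r) (p2 - r)"
    and eq: "M = U * S * transpose_mat V + Up * Sp * transpose_mat Vp"
    by blast+
  have Sc: "S \<in> carrier_mat r r" "Sp \<in> carrier_mat (p1 - r) (p2 - r)"
    using S Sp by auto
  have US: "join_cols U Up * sv_diag M 0 p1 p2
      = four_block_mat (U * S) (Up * Sp) (0\<^sub>m 0 r) (0\<^sub>m 0 (p2 - r))"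
    unfolding join_cols_eq_four_block[OF U Up] sv_diag_four_block[OF r, symmetric]
      S[symmetric] Sp[symmetric]
    using U Up Sc
    by (subst mult_four_block_mat[of _ p1 r _ "p1 - r" _ 0 _ _ r _ "p2 - r"]) auto
  have "join_cols U Up * sv_diag M 0 p1 p2 * transpose_mat (join_cols V Vp)
      = four_block_mat (U * S * transpose_mat V + Up * Sp * transpose_mat Vp)
          (0\<^sub>m p1 0) (0\<^sub>m 0 p2) (0\<^sub>m 0 0)"
    unfolding US join_cols_eq_four_block[OF V Vp]
    using U Up Sc V Vp
    by (simp add: transpose_four_block_mat[of _ p2 r _ "p2 - r" _ 0]
        mult_four_block_mat[of _ p1 r _ "p2 - r" _ 0 _ _ p2 _ 0])
  also have "\<dots> = M"
    unfolding eq[symmetric] using M by (intro eq_matI) auto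
  finally have product: "join_cols U Up * sv_diag M 0 p1 p2 * transpose_mat (join_cols V Vp) = M" .
  from d have "orthogonal_matrix p1 (join_cols U Up)" and "orthogonal_matrix p2 (join_cols V Vp)"
    by blast+
  then show ?thesis
    using product[symmetric] M unfolding is_svd_def carrier_matD[OF M] by blast
qed

section \<open>Vanishing singular values and rank\<close>

text \<open>\<open>M\<^sup>T M = B (D\<^sup>T D) B\<^sup>T\<close> is an orthogonal similarity with a diagonal matrix, and so its
  characteristic polynomial splits over the reals into the factors given by that diagonal.\<close>

lemma proots_gram_of_diagonalization:
  assumes A: "orthogonal_matrix m A" and B: "orthogonal_matrix n B"
    and D: "D \<in> carrier_mat m n" and diag: "\<And>i j. i < m \<Longrightarrow> j < n \<Longrightarrow> i \<noteq> j \<Longrightarrow> D $$ (i, j) = 0"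
    and M: "M = A * D * transpose_mat B"
  shows "proots (char_poly (transpose_mat M * M)) = mset (diag_mat (transpose_mat D * D))"
proof -
  have Ac: "A \<in> carrier_mat m m" and AA: "transpose_mat A * A = 1\<^sub>m m"
    and Bc: "B \<in> carrier_mat n n" and BB: "transpose_mat B * B = 1\<^sub>m n" "B * transpose_mat B = 1\<^sub>m n"
    using A B by (auto simp: orthogonal_matrix_def)
  have Dt: "transpose_mat D \<in> carrier_mat n m" and Bt: "transpose_mat B \<in> carrier_mat n n"
    and At: "transpose_mat A \<in> carrier_mat m m"
    using D Bc Ac by auto
  have "transpose_mat M * M = B * (transpose_mat D * (transpose_mat A * (A * (D * transpose_mat B))))"
    unfolding M transpose_sandwich[OF Ac D Bc]
    using Ac D Bc by (simp add: assoc_mult_mat[of _ _ n _ m _ n] assoc_mult_mat[of _ _ m _ n _ n] assoc_mult_mat[of _ _ m _ m _ n]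
        assoc_mult_mat[of _ _ n _ n _ m] assoc_mult_mat[of _ _ n _ n _ n])
  also have "transpose_mat A * (A * (D * transpose_mat B)) = D * transpose_mat B"
    using assoc_mult_mat[OF At Ac, of "D * transpose_mat B" n] AA D Bt by simp
  also have "B * (transpose_mat D * (D * transpose_mat B)) = B * (transpose_mat D * D) * transpose_mat B"
    using D Bc by (simp add: assoc_mult_mat[of _ n m _ n _ n] assoc_mult_mat[of _ n n _ n _ n])
  finally have sim: "similar_mat (transpose_mat M * M) (transpose_mat D * D)"
    using D Bc BB by (intro similar_matI[of _ _ B "transpose_mat B" n]) auto
  have ut: "upper_triangular (transpose_mat D * D)"
  proof
    fix i j assume "j < i" "i < dim_row (transpose_mat D * D)"
    then have "D $$ (k, i) * D $$ (k, j) = 0" if "k < m" for k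
      using D diag[of k i] diag[of k j] that by (cases "k = i") auto
    then show "(transpose_mat D * D) $$ (i, j) = 0"
      using D \<open>j < i\<close> \<open>i < dim_row (transpose_mat D * D)\<close> by (auto simp: scalar_prod_def intro!: sum.neutral)
  qed
  have nonzero: "(\<Prod>a\<leftarrow>as. [:- a, 1:]) \<noteq> 0" for as :: "real list"
    by (induction as) (simp_all del: mult_pCons_left)
  have "proots (\<Prod>a\<leftarrow>as. [:- a, 1:]) = mset as" for as :: "real list"
  proof (induction as)
    case (Cons a as)
    have "proots ([:- a, 1:] * (\<Prod>a\<leftarrow>as. [:- a, 1:])) = proots [:- a, 1:] + proots (\<Prod>a\<leftarrow>as. [:- a, 1:])"
      by (rule proots_mult) (use nonzero in simp_all)
    with Cons show ?case by (simp del: mult_pCons_left)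
  qed simp
  then show ?thesis
    unfolding char_poly_similar[OF sim]
    using char_poly_upper_triangular[OF _ ut, of n] D by simp
qed

text \<open>The \<open>j\<close>-th diagonal entry of \<open>D\<^sup>T D\<close> is the squared norm of column \<open>j\<close> of \<open>D\<close>. The length
  guarantees that the list access in the definition of a singular value is never out of range.\<close>

lemma gram_eigenvalues_of_svd:
  assumes svd: "is_svd M A D B"
  shows "length (gram_eigenvalues M) = dim_col M" and "\<forall>x \<in> set (gram_eigenvalues M). 0 \<le> x"
proof -
  from svd have A: "orthogonal_matrix (dim_row M) A" and B: "orthogonal_matrix (dim_col M) B"
    and Sv: "D = sv_diag M 0 (dim_row M) (dim_col M)" and M: "M = A * D * transpose_mat B"
    unfolding is_svd_def by blast+
  have D: "D \<in> carrier_mat (dim_row M) (dim_col M)"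
    and diag: "\<And>i j. i < dim_row M \<Longrightarrow> j < dim_col M \<Longrightarrow> i \<noteq> j \<Longrightarrow> D $$ (i, j) = 0"
    unfolding Sv by (simp_all add: sv_diag_def)
  from proots_gram_of_diagonalization[OF A B D diag M]
  have "mset (gram_eigenvalues M) = mset (diag_mat (transpose_mat D * D))"
    by (simp add: gram_eigenvalues_def)
  from mset_eq_length[OF this] mset_eq_setD[OF this]
  show "length (gram_eigenvalues M) = dim_col M" and "\<forall>x \<in> set (gram_eigenvalues M). 0 \<le> x"
    using D by (auto simp: diag_mat_def scalar_prod_def intro!: sum_nonneg)
qed

text \<open>The eigenvalues are sorted in decreasing order and nonnegative. Index 0 must be excluded,
  since \<open>singular_value M 0\<close> is 0 by convention.\<close>

lemma singular_value_zero_propagates: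
  assumes svd: "is_svd M A D B" and zero: "singular_value M k = 0" and k: "1 \<le> k" and kl: "k \<le> l"
  shows "singular_value M l = 0"
proof (cases "l \<le> min (dim_row M) (dim_col M)")
  case True
  let ?g = "gram_eigenvalues M"
  have len: "length ?g = dim_col M" and nonneg: "\<forall>x \<in> set ?g. 0 \<le> x"
    using gram_eigenvalues_of_svd[OF svd] .
  have "sorted (rev ?g)" by (simp add: gram_eigenvalues_def)
  then have "?g ! (l - 1) \<le> ?g ! (k - 1)"
    using True k kl len by (intro sorted_rev_nth_mono) auto
  moreover have "?g ! (k - 1) = 0"
    using zero True k kl by (simp add: singular_value_def)
  moreover have "0 \<le> ?g ! (l - 1)"
    using nonneg True k kl len by auto
  ultimately show ?thesis by (simp add: singular_value_def)
qed (auto simp: singular_value_def)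

text \<open>The matrix is a sum of \<open>m\<close> outer products, and rank is subadditive.\<close>

lemma (in vec_space) rank_sum_of_products_le:
  fixes f g :: "nat \<Rightarrow> nat \<Rightarrow> 'a"
  shows "rank (mat n nc (\<lambda>(i, j). \<Sum>k<m. f k i * g k j)) \<le> m"
proof (induction m)
  case 0
  have "mat n nc (\<lambda>(i, j). \<Sum>k<0. f k i * g k j) = 0\<^sub>m n nc" by (intro eq_matI) auto
  then show ?case using rank_0I[of nc] by (simp only: le_refl)
next
  case (Suc m)
  let ?M = "\<lambda>m. mat n nc (\<lambda>(i, j). \<Sum>k<m. f k i * g k j)"
  let ?R = "mat n nc (\<lambda>(i, j). f m i * g m j)"
  have "?M (Suc m) = ?M m + ?R" by (intro eq_matI) auto
  then have "rank (?M (Suc m)) \<le> rank (?M m) + rank ?R"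
    using rank_subadditive[of "?M m" nc ?R] by simp
  moreover have "rank ?R \<le> 1"
    by (rule rank_le_1_product_entries[of _ nc "f m" "g m"]) auto
  ultimately show ?case using Suc by simp
qed

text \<open>With all singular values from the \<open>k\<close>-th on equal to zero, only the first \<open>k - 1\<close> outer
  products of left and right singular vectors remain.\<close>

lemma rank_less_of_singular_value_zero:
  assumes svd: "is_svd M A D B" and zero: "singular_value M k = 0"
    and k: "1 \<le> k" "k \<le> min (dim_row M) (dim_col M)"
  shows "vec_space.rank (dim_row M) M < k"
proof -
  define m n where "m = dim_row M" and "n = dim_col M"
  from svd have Ac: "A \<in> carrier_mat m m" and Bc: "B \<in> carrier_mat n n"
    and D: "D = sv_diag M 0 m n" and M: "M = A * D * transpose_mat B"
    unfolding is_svd_def orthogonal_matrix_def m_def n_def by blast+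
  have Dc: "D \<in> carrier_mat m n" unfolding D by simp
  have AD: "(A * D) $$ (i, l) = (if l < m then A $$ (i, l) * singular_value M (l + 1) else 0)"
    if "i < m" "l < n" for i l
  proof -
    have "(A * D) $$ (i, l) = (\<Sum>q = 0..<m. A $$ (i, q) * D $$ (q, l))"
      using that Ac Dc by (simp add: scalar_prod_def)
    also have "\<dots> = (\<Sum>q = 0..<m. if q = l then A $$ (i, l) * singular_value M (l + 1) else 0)"
      unfolding D using that by (intro sum.cong) (auto simp: sv_diag_def)
    finally show ?thesis by simp
  qed
  have entry: "M $$ (i, j) = (\<Sum>l<k - 1. (A $$ (i, l) * singular_value M (l + 1)) * B $$ (j, l))"
    if ij: "i < m" "j < n" for i j
  proof -
    have "(C * transpose_mat B) $$ (i, j) = (\<Sum>l = 0..<n. C $$ (i, l) * B $$ (j, l))"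
      if "C \<in> carrier_mat m n" for C
      using that ij Bc by (simp add: scalar_prod_def)
    from this[OF mult_carrier_mat[OF Ac Dc]]
    have "M $$ (i, j) = (\<Sum>l = 0..<n. (A * D) $$ (i, l) * B $$ (j, l))"
      unfolding M[symmetric] .
    also have "\<dots> = (\<Sum>l<k - 1. (A * D) $$ (i, l) * B $$ (j, l))"
    proof (rule sum.mono_neutral_right)
      show "\<forall>l\<in>{0..<n} - {..<k - 1}. (A * D) $$ (i, l) * B $$ (j, l) = 0"
      proof
        fix l assume l: "l \<in> {0..<n} - {..<k - 1}"
        have "singular_value M (l + 1) = 0"
          using singular_value_zero_propagates[OF svd zero k(1), of "l + 1"] l by auto
        then show "(A * D) $$ (i, l) * B $$ (j, l) = 0"
          using AD[OF ij(1), of l] l by simp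
      qed
    qed (use k in \<open>auto simp: n_def\<close>)
    also have "\<dots> = (\<Sum>l<k - 1. (A $$ (i, l) * singular_value M (l + 1)) * B $$ (j, l))"
    proof (intro sum.cong refl)
      fix l assume "l \<in> {..<k - 1}"
      with k have "l < m" "l < n" by (auto simp: m_def n_def)
      with AD[OF ij(1)] show "(A * D) $$ (i, l) * B $$ (j, l) = A $$ (i, l) * singular_value M (l + 1) * B $$ (j, l)"
        by simp
    qed
    finally show ?thesis .
  qed
  have "M = mat m n (\<lambda>(i, j). \<Sum>l<k - 1. (A $$ (i, l) * singular_value M (l + 1)) * B $$ (j, l))"
    using entry by (intro eq_matI) (auto simp: m_def n_def)
  then have "vec_space.rank m M \<le> k - 1"
    using vec_space.rank_sum_of_products_le[of m n "\<lambda>l i. A $$ (i, l) * singular_value M (l + 1)" "\<lambda>l j. B $$ (j, l)" "k - 1"]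
    by simp
  then show ?thesis using k by (simp add: m_def)
qed

text \<open>If a diagonal entry were zero, the rank of \<open>M\<close> would be less than \<open>r\<close>.\<close>

lemma leading_sv_diag_invertible:
  assumes svd: "is_svd M A D B" and rank: "r \<le> vec_space.rank (dim_row M) M"
    and r: "r \<le> min (dim_row M) (dim_col M)"
  defines "S \<equiv> sv_diag M 0 r r"
  shows "invertible_mat S" and "S * inverse_mat S = 1\<^sub>m r" and "inverse_mat S \<in> carrier_mat r r"
proof -
  have S: "S \<in> carrier_mat r r" by (simp add: S_def)
  have "upper_triangular S" by (auto simp: S_def sv_diag_def)
  then have "det S = prod_list (diag_mat S)" using S by (rule det_upper_triangular)
  moreover have "singular_value M (i + 1) \<noteq> 0" if "i < r" for i
    using rank_less_of_singular_value_zero[OF svd, of "i + 1"] rank r that by auto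
  ultimately have "det S \<noteq> 0"
    by (auto simp: prod_list_zero_iff diag_mat_def S_def sv_diag_def)
  from det_non_zero_imp_unit[OF S this, where b = "()"]
  obtain T where T: "mat_inverse S = Some T"
    using mat_inverse(1)[OF S, where b = "()"] by (cases "mat_inverse S") auto
  from mat_inverse(2)[OF S T] have "S * T = 1\<^sub>m r" "T * S = 1\<^sub>m r" "T \<in> carrier_mat r r" by auto
  then show "invertible_mat S" and "S * inverse_mat S = 1\<^sub>m r" and "inverse_mat S \<in> carrier_mat r r"
    using S T by (auto simp: inverse_mat_def invertible_mat_def inverts_mat_def)
qed

section \<open>Leading singular blocks\<close>

text \<open>Orthonormality of \<open>V\<close> removes \<open>V\<^sup>T V\<close> from the first summand and orthogonality of \<open>V\<close> and
  \<open>V\<^sub>\<bottom>\<close> kills the second. The lemma is stated without singular values so that it also applies to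
  the transposed decomposition, with \<open>S\<^sub>\<bottom>\<^sup>T\<close> in place of \<open>S\<^sub>\<bottom>\<close>.\<close>

lemma diagonal_block_intertwines:
  fixes U V Up Vp S Sp :: "real mat"
  assumes U: "U \<in> carrier_mat m r" and Up: "Up \<in> carrier_mat m a" and V: "V \<in> carrier_mat n r"
    and Vp: "Vp \<in> carrier_mat n b" and S: "S \<in> carrier_mat r r" and Sp: "Sp \<in> carrier_mat a b"
    and VV: "transpose_mat V * V = 1\<^sub>m r" and VpV: "transpose_mat Vp * V = 0\<^sub>m b r"
  shows "(U * S * transpose_mat V + Up * Sp * transpose_mat Vp) * V = U * S"
proof -
  have "(U * S * transpose_mat V + Up * Sp * transpose_mat Vp) * V
      = U * S * transpose_mat V * V + Up * Sp * transpose_mat Vp * V"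
    using U Up V Vp S Sp by (intro add_mult_distrib_mat[of _ m n _ _ r]) auto
  also have "U * S * transpose_mat V * V = U * S"
    using assoc_mult_mat[of "U * S" m r "transpose_mat V" n V r] U S V VV by simp
  also have "Up * Sp * transpose_mat Vp * V = 0\<^sub>m m r"
    using assoc_mult_mat[of "Up * Sp" m b "transpose_mat Vp" n V r] Up Sp Vp V VpV by simp
  finally show ?thesis using U S by simp
qed

text \<open>Transposing the decomposition exchanges \<open>U\<close> and \<open>V\<close> but keeps \<open>S\<close>, a square diagonal matrix,
  so that both equations are instances of the same fact.\<close>

lemma partitioned_svd_intertwines:
  assumes svd: "partitioned_svd p1 p2 r M U S V Up Sp Vp" and r: "r \<le> p1" "r \<le> p2"
  shows "M * V = U * S" and "transpose_mat M * U = V * S"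
proof -
  note d = svd[unfolded partitioned_svd_def]
  from d have U: "U \<in> carrier_mat p1 r"
    and Up: "Up \<in> carrier_mat p1 (p1 - r)" and V: "V \<in> carrier_mat p2 r"
    and Vp: "Vp \<in> carrier_mat p2 (p2 - r)"
    and S_def: "S = sv_diag M 0 r r" and Sp_def: "Sp = sv_diag M r (p1 - r) (p2 - r)"
    and oJ: "orthogonal_matrix p1 (join_cols U Up)" and oK: "orthogonal_matrix p2 (join_cols V Vp)"
    and M: "M = U * S * transpose_mat V + Up * Sp * transpose_mat Vp"
    by blast+
  have Sc: "S \<in> carrier_mat r r" "Sp \<in> carrier_mat (p1 - r) (p2 - r)"
    unfolding S_def Sp_def by simp_all
  have J: "transpose_mat (join_cols U Up) * join_cols U Up = 1\<^sub>m (r + (p1 - r))"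
    and K: "transpose_mat (join_cols V Vp) * join_cols V Vp = 1\<^sub>m (r + (p2 - r))"
    using oJ oK r by (auto simp: orthogonal_matrix_def)
  note oU = join_cols_orthogonal_blocks[OF U Up J] and oV = join_cols_orthogonal_blocks[OF V Vp K]
  show "M * V = U * S"
    unfolding M by (rule diagonal_block_intertwines[OF U Up V Vp Sc oV])
  have "transpose_mat S = S"
    unfolding S_def by (intro eq_matI) (auto simp: sv_diag_def)
  then have "transpose_mat M = V * S * transpose_mat U + Vp * transpose_mat Sp * transpose_mat Up"
    unfolding M using U Up V Vp Sc transpose_sandwich[OF U Sc(1) V] transpose_sandwich[OF Up Sc(2) Vp]
    by (subst transpose_add[of _ p1 p2]) auto
  then show "transpose_mat M * U = V * S"
    using diagonal_block_intertwines[OF V Vp U Up Sc(1) _ oU, of "transpose_mat Sp"] Sc by simp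
qed

section \<open>The decomposition\<close>

text \<open>The projection \<open>P = I - U U\<^sup>T\<close> annihilates \<open>U\<close> and therefore \<open>X V = U S\<close>. This leaves
  \<open>P (X + E) Vh Si = P Uh Sh Si = P Uh\<close> as the sum of the first three terms.\<close>

lemma perturbed_factor_decomposition:
  fixes X E U V Uh Vh S Sh Si T1 T2 :: "real mat"
  assumes X: "X \<in> carrier_mat m n" and E: "E \<in> carrier_mat m n"
    and U: "U \<in> carrier_mat m r" and Uh: "Uh \<in> carrier_mat m r"
    and V: "V \<in> carrier_mat n r" and Vh: "Vh \<in> carrier_mat n r"
    and S: "S \<in> carrier_mat r r" and Sh: "Sh \<in> carrier_mat r r" and Si: "Si \<in> carrier_mat r r"
    and T1: "T1 \<in> carrier_mat r r" and T2: "T2 \<in> carrier_mat r r"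
    and UU: "transpose_mat U * U = 1\<^sub>m r"
    and XV: "X * V = U * S" and XVh: "(X + E) * Vh = Uh * Sh" and inv: "Sh * Si = 1\<^sub>m r"
  shows "Uh - U * T1 =
      (1\<^sub>m m - U * transpose_mat U) * E * V * T2 * Si
    + (1\<^sub>m m - U * transpose_mat U) * E * (Vh - V * T2) * Si
    + (1\<^sub>m m - U * transpose_mat U) * X * (Vh - V * transpose_mat V * Vh) * Si
    + U * (transpose_mat U * Uh - T1)"
proof -
  define P where "P = 1\<^sub>m m - U * transpose_mat U"
  have P: "P \<in> carrier_mat m m" unfolding P_def using U by (intro minus_carrier_mat) auto
  have PE: "P * E \<in> carrier_mat m n" and PX: "P * X \<in> carrier_mat m n" using P E X by auto
  have UUt: "U * transpose_mat U \<in> carrier_mat m m" and Ut: "transpose_mat U \<in> carrier_mat r m"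
    using U by auto
  have P_mult: "P * Y = Y - U * (transpose_mat U * Y)" if "Y \<in> carrier_mat m r" for Y
    unfolding P_def minus_mult_distrib_mat[OF one_carrier_mat UUt that]
    using that U assoc_mult_mat[OF U Ut that] by simp
  have PU: "P * U = 0\<^sub>m m r" using P_mult[OF U] U UU by simp
  \<comment> \<open>The part of \<open>X\<close> outside the range of \<open>U\<close> does not see \<open>V\<close>.\<close>
  have "P * X * V = P * U * S"
    using assoc_mult_mat[OF P X V] assoc_mult_mat[OF P U S] XV by simp
  then have PXV: "P * X * V = 0\<^sub>m m r" using PU S by simp
  \<comment> \<open>Here \<open>T2\<close> cancels, so it may be arbitrary.\<close>
  have e: "P * E * V * T2 * Si + P * E * (Vh - V * T2) * Si = P * E * Vh * Si"
  proof -
    have c: "P * E * V * T2 \<in> carrier_mat m r" "P * E * Vh \<in> carrier_mat m r"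
      using PE V Vh T2 by auto
    have VT: "V * T2 \<in> carrier_mat n r" using V T2 by auto
    have "P * E * (Vh - V * T2) = P * E * Vh - P * E * V * T2"
      using mult_minus_distrib_mat[OF PE Vh VT] assoc_mult_mat[OF PE V T2] by simp
    then have "P * E * (Vh - V * T2) * Si = P * E * Vh * Si - P * E * V * T2 * Si"
      using minus_mult_distrib_mat[OF c(2,1) Si] by simp
    moreover have "P * E * Vh * Si \<in> carrier_mat m r" "P * E * V * T2 * Si \<in> carrier_mat m r"
      using c Si by auto
    ultimately show ?thesis by (intro eq_matI) (auto simp del: index_mult_mat(1))
  qed
  have x: "P * X * (Vh - V * transpose_mat V * Vh) = P * X * Vh"
  proof -
    have VV: "transpose_mat V * Vh \<in> carrier_mat r r" using V Vh by auto
    have "V * transpose_mat V * Vh = V * (transpose_mat V * Vh)"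
      using assoc_mult_mat[OF V _ Vh, of "transpose_mat V"] V by simp
    moreover have "P * X * (V * (transpose_mat V * Vh)) = 0\<^sub>m m r"
      using assoc_mult_mat[OF PX V VV, symmetric] left_mult_zero_mat[OF VV, of m] unfolding PXV
      by (rule trans)
    moreover have "P * X * Vh \<in> carrier_mat m r" "V * (transpose_mat V * Vh) \<in> carrier_mat n r"
      using PX Vh V by auto
    ultimately show ?thesis
      using P Vh mult_minus_distrib_mat[OF PX Vh, of "V * (transpose_mat V * Vh)"]
      by (intro eq_matI) (auto simp del: index_mult_mat(1))
  qed
  have "P * E * Vh * Si + P * X * Vh * Si = (P * E * Vh + P * X * Vh) * Si"
    using PE PX Vh Si by (intro add_mult_distrib_mat[symmetric, of _ m r]) auto
  also have "P * E * Vh + P * X * Vh = (P * E + P * X) * Vh"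
    using PE PX Vh by (intro add_mult_distrib_mat[symmetric]) auto
  also have "P * E + P * X = P * (X + E)"
    using mult_add_distrib_mat[OF P X E] PE PX by (simp add: comm_add_mat)
  also have "P * (X + E) * Vh = P * (Uh * Sh)"
    using assoc_mult_mat[OF P _ Vh, of "X + E"] X E XVh by simp
  also have "P * (Uh * Sh) * Si = P * Uh"
    using P Uh Sh Si inv
    by (simp add: assoc_mult_mat[of _ m m _ r _ r] assoc_mult_mat[of _ m r _ r _ r])
  also have "\<dots> = Uh - U * (transpose_mat U * Uh)" by (rule P_mult[OF Uh])
  finally have main: "P * E * Vh * Si + P * X * Vh * Si = Uh - U * (transpose_mat U * Uh)" .
  have UtUh: "transpose_mat U * Uh \<in> carrier_mat r r" using U Uh by auto
  have last: "U * (transpose_mat U * Uh - T1) = U * (transpose_mat U * Uh) - U * T1"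
    by (rule mult_minus_distrib_mat[OF U UtUh T1])
  have "Uh - U * (transpose_mat U * Uh) + (U * (transpose_mat U * Uh) - U * T1) = Uh - U * T1"
    using U Uh UtUh T1 by (intro eq_matI) (auto simp del: index_mult_mat(1))
  then show ?thesis
    unfolding P_def[symmetric] e x main last by simp
qed

lemma procrustes_carrier:
  assumes "is_procrustes U Uh W" and "U \<in> carrier_mat m r" and "Uh \<in> carrier_mat m r"
  shows "W \<in> carrier_mat r r"
proof -
  obtain W1 D W2 where "orthogonal_matrix (dim_row (transpose_mat U * Uh)) W1"
    and "orthogonal_matrix (dim_col (transpose_mat U * Uh)) W2" and "W = W1 * transpose_mat W2"
    using assms(1) unfolding is_procrustes_def is_svd_def by blast
  then show ?thesis using assms(2,3) by (auto simp: orthogonal_matrix_def)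
qed

theorem theorem3p1:
  fixes p1 p2 r :: nat
    and X E Xh U S V Up Sp Vp Uh Sh Vh Uhp Shp Vhp WU WV :: "real mat"
  assumes "p1 \<ge> 1" and "p2 \<ge> 1" and "r \<ge> 1" and "r \<le> min p1 p2"
    and "X \<in> carrier_mat p1 p2" and "E \<in> carrier_mat p1 p2" and "Xh = X + E"
    and "partitioned_svd p1 p2 r X U S V Up Sp Vp"
    and "partitioned_svd p1 p2 r Xh Uh Sh Vh Uhp Shp Vhp"
    and "singular_value X r > singular_value X (r + 1)"
    and "is_procrustes U Uh WU" and "is_procrustes V Vh WV"
    and "vec_space.rank p1 Xh \<ge> r"
  shows "invertible_mat Sh \<and>
    Uh - U * WU =
        (1\<^sub>m p1 - U * transpose_mat U) * E * V * WV * inverse_mat Sh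
      + (1\<^sub>m p1 - U * transpose_mat U) * E * (Vh - V * WV) * inverse_mat Sh
      + (1\<^sub>m p1 - U * transpose_mat U) * X * (Vh - V * transpose_mat V * Vh) * inverse_mat Sh
      + U * (transpose_mat U * Uh - WU) \<and>
    (\<forall>T1 \<in> carrier_mat r r. \<forall>T2 \<in> carrier_mat r r.
      Uh - U * T1 =
          (1\<^sub>m p1 - U * transpose_mat U) * E * V * T2 * inverse_mat Sh
        + (1\<^sub>m p1 - U * transpose_mat U) * E * (Vh - V * T2) * inverse_mat Sh
        + (1\<^sub>m p1 - U * transpose_mat U) * X * (Vh - V * transpose_mat V * Vh) * inverse_mat Sh
        + U * (transpose_mat U * Uh - T1)) \<and>
    Vh - V * WV =
        (1\<^sub>m p2 - V * transpose_mat V) * transpose_mat E * U * WU * inverse_mat Sh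
      + (1\<^sub>m p2 - V * transpose_mat V) * transpose_mat E * (Uh - U * WU) * inverse_mat Sh
      + (1\<^sub>m p2 - V * transpose_mat V) * transpose_mat X * (Uh - U * transpose_mat U * Uh) * inverse_mat Sh
      + V * (transpose_mat V * Vh - WV)"
proof -
  have r: "r \<le> p1" "r \<le> p2" using assms(4) by auto
  note Xsvd = assms(8) and Xhsvd = assms(9)
  have U: "U \<in> carrier_mat p1 r" and V: "V \<in> carrier_mat p2 r"
    and Uh: "Uh \<in> carrier_mat p1 r" and Vh: "Vh \<in> carrier_mat p2 r"
    and Sh: "Sh = sv_diag Xh 0 r r" and Xh: "Xh \<in> carrier_mat p1 p2"
    and Uo: "orthonormal_cols U" and Vo: "orthonormal_cols V"
    and "S = sv_diag X 0 r r"
    using Xsvd Xhsvd unfolding partitioned_svd_def by blast+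
  have S: "S \<in> carrier_mat r r" unfolding \<open>S = sv_diag X 0 r r\<close> by simp
  have UU: "transpose_mat U * U = 1\<^sub>m r" and VV: "transpose_mat V * V = 1\<^sub>m r"
    using Uo Vo U V by (auto simp: orthonormal_cols_def)
  have Shc: "Sh \<in> carrier_mat r r" using Sh by simp
  have inv: "invertible_mat Sh" "Sh * inverse_mat Sh = 1\<^sub>m r" "inverse_mat Sh \<in> carrier_mat r r"
    using leading_sv_diag_invertible[OF partitioned_svd_is_svd[OF Xhsvd r], of r] assms(4,13) Xh Sh by auto
  have WU: "WU \<in> carrier_mat r r" and WV: "WV \<in> carrier_mat r r"
    using procrustes_carrier[OF assms(11) U Uh] procrustes_carrier[OF assms(12) V Vh] .
  note X = assms(5) and E = assms(6)
  have Et: "transpose_mat E \<in> carrier_mat p2 p1" and Xt: "transpose_mat X \<in> carrier_mat p2 p1"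
    using E X by auto
  note XV = partitioned_svd_intertwines[OF Xsvd r]
  note XhV = partitioned_svd_intertwines[OF Xhsvd r, unfolded assms(7) transpose_add[OF X E]]
  note left = perturbed_factor_decomposition[OF X E U Uh V Vh S Shc inv(3) _ _ UU XV(1) XhV(1) inv(2)]
  note right = perturbed_factor_decomposition[OF Xt Et V Vh U Uh S Shc inv(3) WV WU VV XV(2) XhV(2) inv(2)]
  show ?thesis
    using inv(1) left[OF WU WV] left right by blast
qed

end
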